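(* Let $G=(V,E)$ be a finite connected undirected graph with $n=|V|$ vertices and a designated sink vertex, modelling a wireless sensor network. The worst-case message complexity (total number of messages sent in the network) of the Distributed Vertex Cover Algorithm with Breadth-First Search Tree run on $G$ is $O(n^3)$.
   Context: Network model: vertices are identical nodes with unique identifiers, edges are unweighted communication links, each node knows its neighbors, and nodes are time-synchronized. Distributed Vertex Cover Algorithm with Breadth-First Search (BFS) Tree, consisting of two rounds. Round 1 (asynchronous BFS construction): the sink has level $0$ and all other nodes initially have level $\infty$; the sink sends an "infrastructure" message carrying level $0$ to all its neighbors. A node receiving an infrastructure message from a sender of level $\ell$ checks whether its own level exceeds $\ell+1$; if so, it sets its level to $\ell+1$, sets its parent to the sender, and sends an infrastructure message with its new level to all its neighbors except the sender. Messages may be delivered asynchronously (with arbitrary finite delays). Round 2 (started after round 1 has stabilized): every node sends its level to all its neighbors. Then each node decides: a node of even level enters the vertex cover set; for each pair of adjacent nodes both of odd level, the one with the higher identifier enters the vertex cover set. Message convention: the message complexity is the worst-case total number of messages sent by all nodes, where a message sent to one neighbor counts as one message; acknowledgements and link-layer retransmissions are not counted. *)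

theory Defs
  imports
    "Graph_Theory.Digraph_Component"
    "HOL-Library.Extended_Nat"
    "HOL-Library.Multiset"
    "HOL-Library.Landau_Symbols"
begin

text \<open>
  A node is identified with its unique identifier, a natural number, so the order on nodes is the
  order on identifiers. An undirected edge is represented by the two opposite arcs
  (\<^const>\<open>pair_graph\<close>: finite, symmetric, loop-free, no parallel arcs).
\<close>

type_synonym node = nat
type_synonym level = enat

definition sensor_network :: "node pair_pre_digraph \<Rightarrow> node \<Rightarrow> bool" where
  "sensor_network G s \<longleftrightarrow>
     pair_graph G \<and> Digraph_Component.connected (with_proj G) \<and> s \<in> pverts G"

definition neighbors :: "node pair_pre_digraph \<Rightarrow> node \<Rightarrow> node set" where
  "neighbors G v = {w. (v, w) \<in> parcs G}"

text \<open>Arguments: sender, receiver, the level of the sender carried by the message.\<close>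

datatype message =
    Infrastructure node node level
  | Level_Info node node level

datatype phase = Idle | Round1 | Round2

text \<open>
  \<open>in_transit\<close> holds the messages sent but not yet delivered; they may be delivered in any order.
  \<open>heard v u\<close> is the level that \<open>v\<close> has received from its neighbor \<open>u\<close> in round 2.
  \<open>in_cover v\<close> is \<^const>\<open>None\<close> as long as \<open>v\<close> has not decided.
\<close>

record config =
  phase :: phase
  level :: "node \<Rightarrow> level"
  parent :: "node \<Rightarrow> node option"
  heard :: "node \<Rightarrow> node \<Rightarrow> level option"
  in_cover :: "node \<Rightarrow> bool option"
  in_transit :: "message multiset"

definition initial_config :: "node \<Rightarrow> config" where
  "initial_config s =
     \<lparr>phase = Idle,
      level = (\<lambda>v. if v = s then 0 else \<infinity>),
      parent = (\<lambda>_. None),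
      heard = (\<lambda>_ _. None),
      in_cover = (\<lambda>_. None),
      in_transit = {#}\<rparr>"

definition infrastructure_to :: "node \<Rightarrow> level \<Rightarrow> node set \<Rightarrow> message multiset" where
  "infrastructure_to v l W = image_mset (\<lambda>w. Infrastructure v w l) (mset_set W)"

definition level_broadcast ::
    "node pair_pre_digraph \<Rightarrow> (node \<Rightarrow> level) \<Rightarrow> message multiset" where
  "level_broadcast G lev = image_mset (\<lambda>(v, w). Level_Info v w (lev v)) (mset_set (parcs G))"

definition even_level :: "level \<Rightarrow> bool" where
  "even_level l \<longleftrightarrow> (\<exists>k. l = enat k \<and> even k)"

definition odd_level :: "level \<Rightarrow> bool" where
  "odd_level l \<longleftrightarrow> (\<exists>k. l = enat k \<and> odd k)"

definition enters_cover :: "node pair_pre_digraph \<Rightarrow> config \<Rightarrow> node \<Rightarrow> bool" where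
  "enters_cover G c v \<longleftrightarrow>
     even_level (level c v) \<or>
     odd_level (level c v) \<and>
       (\<exists>u \<in> neighbors G v. \<exists>l. heard c v u = Some l \<and> odd_level l \<and> u < v)"

text \<open>
  \<open>step G s c out c'\<close>: one atomic step from \<open>c\<close> to \<open>c'\<close> during which exactly the messages in the
  multiset \<open>out\<close> are sent.
\<close>

inductive step ::
    "node pair_pre_digraph \<Rightarrow> node \<Rightarrow> config \<Rightarrow> message multiset \<Rightarrow> config \<Rightarrow> bool"
  for G :: "node pair_pre_digraph" and s :: node
where
  start_round1:
    "\<lbrakk>phase c = Idle; out = infrastructure_to s 0 (neighbors G s)\<rbrakk> \<Longrightarrow>
     step G s c out (c\<lparr>phase := Round1, in_transit := out\<rparr>)"
| adopt:
    "\<lbrakk>Infrastructure u v l \<in># in_transit c; level c v > l + 1;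
      out = infrastructure_to v (l + 1) (neighbors G v - {u})\<rbrakk> \<Longrightarrow>
     step G s c out
       (c\<lparr>level := (level c)(v := l + 1),
          parent := (parent c)(v := Some u),
          in_transit := in_transit c - {#Infrastructure u v l#} + out\<rparr>)"
| ignore:
    "\<lbrakk>Infrastructure u v l \<in># in_transit c; \<not> level c v > l + 1\<rbrakk> \<Longrightarrow>
     step G s c {#} (c\<lparr>in_transit := in_transit c - {#Infrastructure u v l#}\<rparr>)"
| start_round2:
    "\<lbrakk>phase c = Round1; in_transit c = {#}; out = level_broadcast G (level c)\<rbrakk> \<Longrightarrow>
     step G s c out (c\<lparr>phase := Round2, in_transit := out\<rparr>)"
| hear:
    "Level_Info u v l \<in># in_transit c \<Longrightarrow>
     step G s c {#}
       (c\<lparr>heard := (heard c)(v := (heard c v)(u := Some l)),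
          in_transit := in_transit c - {#Level_Info u v l#}\<rparr>)"
| decide:
    "\<lbrakk>phase c = Round2; v \<in> pverts G; in_cover c v = None;
      \<forall>u \<in> neighbors G v. heard c v u \<noteq> None\<rbrakk> \<Longrightarrow>
     step G s c {#} (c\<lparr>in_cover := (in_cover c)(v := Some (enters_cover G c v))\<rparr>)"

text \<open>
  \<open>execution G s c m\<close>: some finite (not necessarily complete) execution leads to \<open>c\<close>, and
  \<open>m\<close> messages have been sent by all nodes together in its course.
\<close>

inductive execution :: "node pair_pre_digraph \<Rightarrow> node \<Rightarrow> config \<Rightarrow> nat \<Rightarrow> bool"
  for G :: "node pair_pre_digraph" and s :: node
where
  init: "execution G s (initial_config s) 0"
| step: "\<lbrakk>execution G s c m; step G s c out c'\<rbrakk> \<Longrightarrow> execution G s c' (m + size out)"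

text \<open>
  The number of messages never decreases along an execution, so the supremum over all finite
  executions is also the supremum of the totals over all complete (a priori even infinite) ones.
\<close>

definition message_complexity :: "node pair_pre_digraph \<Rightarrow> node \<Rightarrow> enat" where
  "message_complexity G s = (SUP m \<in> {m. \<exists>c. execution G s c m}. enat m)"

definition worst_case_message_complexity :: "nat \<Rightarrow> enat" where
  "worst_case_message_complexity n =
     (SUP (G, s) \<in> {(G, s). sensor_network G s \<and> card (pverts G) = n}. message_complexity G s)"

end

theory Submission
  imports Defs
begin

text \<open>
  Whenever a message of level \<open>k\<close> is in transit, more than \<open>k\<close> nodes have level at most \<open>k\<close>: a node
  that adopts level \<open>k + 1\<close> had a greater level before, so it is new among the nodes of level at most
  \<open>k + 1\<close>. Hence adopted levels are below \<open>n\<close>. As levels only decrease, a node adopts a new level at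
  most \<open>n\<close> times, each time sending at most \<open>n\<close> messages. This gives \<open>n\<^sup>3\<close> messages, to which the
  first broadcast of the sink adds at most \<open>n\<close> and round 2 at most \<open>n\<^sup>2\<close>.
\<close>

section \<open>Finiteness of the network and sizes of broadcasts\<close>

lemma sensor_network_pair_fin_digraph:
  assumes "sensor_network G s"
  shows "pair_fin_digraph G"
proof -
  interpret pair_graph G
    using assms by (simp add: sensor_network_def)
  show ?thesis
    by unfold_locales
qed

lemma sensor_network_finite: "sensor_network G s \<Longrightarrow> finite (pverts G)"
  by (rule pair_fin_digraph.pair_finite_verts[OF sensor_network_pair_fin_digraph])

lemma sensor_network_sink: "sensor_network G s \<Longrightarrow> s \<in> pverts G"
  by (simp add: sensor_network_def)

lemma sensor_network_parcs:
  assumes "sensor_network G s"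
  shows "parcs G \<subseteq> pverts G \<times> pverts G"
proof -
  interpret pair_fin_digraph G
    by (rule sensor_network_pair_fin_digraph[OF assms])
  show ?thesis
    using in_arcsD1 in_arcsD2 by auto
qed

lemma sensor_network_neighbors: "sensor_network G s \<Longrightarrow> neighbors G v \<subseteq> pverts G"
  using sensor_network_parcs by (auto simp: neighbors_def)

lemma size_infrastructure_to_le:
  assumes "sensor_network G s" and "W \<subseteq> neighbors G v"
  shows "size (infrastructure_to v l W) \<le> card (pverts G)"
  using assms sensor_network_neighbors[of G s v] sensor_network_finite[of G s]
  by (auto simp: infrastructure_to_def intro!: card_mono)

lemma Infrastructure_in_infrastructure_to:
  assumes "sensor_network G s" and "W \<subseteq> neighbors G v"
    and "Infrastructure x y k \<in># infrastructure_to v l W"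
  shows "x = v" "y \<in> pverts G" "k = l"
proof -
  have "finite W"
    using assms sensor_network_neighbors[of G s v] sensor_network_finite[of G s]
    by (meson finite_subset)
  then show "x = v" "y \<in> pverts G" "k = l"
    using assms sensor_network_neighbors[of G s v] by (auto simp: infrastructure_to_def)
qed

lemma size_level_broadcast_le:
  assumes "sensor_network G s"
  shows "size (level_broadcast G lev) \<le> card (pverts G) ^ 2"
proof -
  have "card (parcs G) \<le> card (pverts G \<times> pverts G)"
    using sensor_network_parcs[OF assms] sensor_network_finite[OF assms]
    by (intro card_mono) auto
  then show ?thesis
    by (simp add: level_broadcast_def card_cartesian_product power2_eq_square)
qed

section \<open>The invariant bounding the levels in transit\<close>

definition nodes_within :: "node pair_pre_digraph \<Rightarrow> config \<Rightarrow> nat \<Rightarrow> node set" where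
  "nodes_within G c k = {w \<in> pverts G. level c w \<le> enat k}"

text \<open>The sink's level 0 supports its first broadcast. Receivers must lie in
  \<open>pverts G\<close> so that an adopting node is counted by
  \<open>nodes_within\<close>.\<close>

definition levels_supported :: "node pair_pre_digraph \<Rightarrow> node \<Rightarrow> config \<Rightarrow> bool" where
  "levels_supported G s c \<longleftrightarrow>
     level c s = 0 \<and>
     (\<forall>u v l. Infrastructure u v l \<in># in_transit c \<longrightarrow>
        v \<in> pverts G \<and> (\<exists>k. l = enat k \<and> k < card (nodes_within G c k)))"

lemma card_nodes_within_mono:
  assumes "finite (pverts G)" and "\<And>w. level c' w \<le> level c w"
  shows "card (nodes_within G c k) \<le> card (nodes_within G c' k)"
  using assms by (auto simp: nodes_within_def intro!: card_mono intro: order_trans)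

lemma card_nodes_within_adopt:
  assumes "finite (pverts G)" and "v \<in> pverts G" and "level c v > enat (Suc k)"
    and "level c' = (level c)(v := enat (Suc k))"
  shows "card (nodes_within G c k) < card (nodes_within G c' (Suc k))"
proof (rule psubset_card_mono)
  show "finite (nodes_within G c' (Suc k))"
    using assms(1) by (simp add: nodes_within_def)
  have "nodes_within G c k \<subseteq> nodes_within G c' (Suc k)"
    using assms(4) by (auto simp: nodes_within_def elim: order_trans)
  moreover have "v \<in> nodes_within G c' (Suc k)" "v \<notin> nodes_within G c k"
    using assms(2-4) by (auto simp: nodes_within_def not_le elim: order.strict_trans[rotated])
  ultimately show "nodes_within G c k \<subset> nodes_within G c' (Suc k)"
    by blast
qed

text \<open>Preservation of the invariant is obtained together with the numeric bound on the adopted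
  level, because the later message count needs that bound as well.\<close>

lemma levels_supported_adopt:
  assumes net: "sensor_network G s" and sup: "levels_supported G s c"
    and msg: "Infrastructure u v l \<in># in_transit c" and gt: "level c v > l + 1"
    and c': "c' = c\<lparr>level := (level c)(v := l + 1),
          parent := (parent c)(v := Some u),
          in_transit := in_transit c - {#Infrastructure u v l#}
            + infrastructure_to v (l + 1) (neighbors G v - {u})\<rparr>"
  obtains k where "l = enat k" "v \<in> pverts G" "Suc k < card (pverts G)" "levels_supported G s c'"
proof -
  note fin = sensor_network_finite[OF net]
  from sup msg obtain k where v: "v \<in> pverts G" and l: "l = enat k"
    and k: "k < card (nodes_within G c k)"
    unfolding levels_supported_def by blast
  have l1: "l + 1 = enat (Suc k)"
    by (simp add: l one_enat_def)
  have new: "Suc k < card (nodes_within G c' (Suc k))"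
    using card_nodes_within_adopt[OF fin v, of k c c'] k gt by (simp add: l1 c')
  also have "\<dots> \<le> card (pverts G)"
    using fin by (auto simp: nodes_within_def intro!: card_mono)
  finally have bound: "Suc k < card (pverts G)" .
  have mono: "card (nodes_within G c j) \<le> card (nodes_within G c' j)" for j
    using gt by (intro card_nodes_within_mono[OF fin]) (auto simp: c')
  \<comment> \<open>Level 0 never exceeds \<open>l + 1\<close>, so the sink never adopts and keeps
    its level.\<close>
  have "v \<noteq> s"
    using gt sup by (auto simp: levels_supported_def)
  moreover have "y \<in> pverts G \<and> (\<exists>j. i = enat j \<and> j < card (nodes_within G c' j))"
    if "Infrastructure x y i \<in># in_transit c'" for x y i
  proof -
    \<comment> \<open>Old messages stay supported because levels only decrease; new ones are
      supported because \<open>v\<close> has just been added to the count.\<close>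
    from that consider "Infrastructure x y i \<in># in_transit c"
      | "Infrastructure x y i \<in># infrastructure_to v (l + 1) (neighbors G v - {u})"
      by (auto simp: c' dest: in_diffD)
    then show ?thesis
    proof cases
      case 1
      then show ?thesis
        using sup mono unfolding levels_supported_def by (meson less_le_trans)
    next
      case 2
      then have "y \<in> pverts G" "i = enat (Suc k)"
        using Infrastructure_in_infrastructure_to[OF net Diff_subset] l1 by metis+
      then show ?thesis
        using new by blast
    qed
  qed
  ultimately have "levels_supported G s c'"
    using sup by (simp add: levels_supported_def c')
  then show thesis
    using that l v bound by blast
qed

lemma levels_supported_step:
  assumes net: "sensor_network G s" and sup: "levels_supported G s c" and "step G s c out c'"
  shows "levels_supported G s c'"
  using assms(3)
proof cases
  case start_round1
  \<comment> \<open>The sink alone gives the strict bound \<open>0 < card\<close> that its level-0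
    messages require.\<close>
  have "s \<in> nodes_within G c' 0"
    using start_round1 sup sensor_network_sink[OF net]
    by (simp add: nodes_within_def levels_supported_def)
  moreover have "finite (nodes_within G c' 0)"
    using sensor_network_finite[OF net] by (simp add: nodes_within_def)
  ultimately have "0 < card (nodes_within G c' 0)"
    by (auto simp: card_gt_0_iff)
  then have "v \<in> pverts G \<and> (\<exists>k. l = enat k \<and> k < card (nodes_within G c' k))"
    if "Infrastructure u v l \<in># in_transit c'" for u v l
    using that start_round1 Infrastructure_in_infrastructure_to[OF net order_refl, of u v l s 0]
    by (auto simp: zero_enat_def)
  then show ?thesis
    using start_round1 sup by (simp add: levels_supported_def)
next
  case (adopt u v l)
  then show ?thesis
    using levels_supported_adopt[OF net sup] by metis
next
  case start_round2
  then show ?thesis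
    using sup by (auto simp: levels_supported_def level_broadcast_def)
qed (use sup in \<open>auto simp: levels_supported_def nodes_within_def dest: in_diffD\<close>)

section \<open>The potential and the amortized message count\<close>

text \<open>Capping at \<open>n\<close> turns \<infinity> into a natural number that can be summed.
  It hides no adoption, since adopted levels are below \<open>n\<close>.\<close>

definition capped_level :: "nat \<Rightarrow> level \<Rightarrow> nat" where
  "capped_level n l = the_enat (min l (enat n))"

lemma capped_level_le: "capped_level n l \<le> n"
  by (cases l) (auto simp: capped_level_def)

lemma capped_level_less: "k < n \<Longrightarrow> enat k < l \<Longrightarrow> capped_level n (enat k) < capped_level n l"
  by (cases l) (auto simp: capped_level_def)

text \<open>The potential: it is at most \<open>n ^ 2\<close> and drops with every adoption, so
  there are at most \<open>n ^ 2\<close> adoptions.\<close>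

definition total_level :: "node pair_pre_digraph \<Rightarrow> config \<Rightarrow> nat" where
  "total_level G c = (\<Sum>v \<in> pverts G. capped_level (card (pverts G)) (level c v))"

lemma total_level_le: "total_level G c \<le> card (pverts G) ^ 2"
  using sum_bounded_above[of "pverts G" _ "card (pverts G)"] capped_level_le
  by (simp add: total_level_def power2_eq_square)

lemma total_level_adopt:
  assumes "finite (pverts G)" "v \<in> pverts G" "k < card (pverts G)" "enat k < level c v"
    and "level c' = (level c)(v := enat k)"
  shows "total_level G c' < total_level G c"
  unfolding total_level_def
  using assms capped_level_less[OF assms(3,4)]
  by (intro sum_strict_mono_ex1) auto

text \<open>Allowance for messages not caused by adoptions: the sink's first broadcast, then the
  exchange of levels in round 2.\<close>

fun phase_budget :: "nat \<Rightarrow> phase \<Rightarrow> nat" where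
  "phase_budget n Idle = 0"
| "phase_budget n Round1 = n"
| "phase_budget n Round2 = n + n ^ 2"

lemma phase_budget_le: "phase_budget n p \<le> n + n ^ 2"
  by (cases p) auto

text \<open>Amortization: the messages of a step are paid for either by a drop of the potential,
  worth \<open>n\<close> messages per unit, or by a growth of the phase allowance. Additions on both
  sides avoid truncated subtraction.\<close>

lemma step_messages:
  assumes net: "sensor_network G s" and sup: "levels_supported G s c" and "step G s c out c'"
  defines "n \<equiv> card (pverts G)"
  shows "size out + n * total_level G c' + phase_budget n (phase c)
    \<le> n * total_level G c + phase_budget n (phase c')"
  using assms(3)
proof cases
  case start_round1
  then show ?thesis
    using size_infrastructure_to_le[OF net order_refl] by (simp add: total_level_def n_def)
next
  case (adopt u v l)
  from adopt levels_supported_adopt[OF net sup] obtain k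
    where k: "l = enat k" "v \<in> pverts G" "Suc k < n"
    unfolding n_def by metis
  have "total_level G c' < total_level G c"
    by (rule total_level_adopt[OF sensor_network_finite[OF net] k(2)])
      (use adopt k in \<open>simp_all add: n_def one_enat_def\<close>)
  then have "n * total_level G c' + n \<le> n * total_level G c"
    by (metis Suc_leI add.commute mult_Suc_right mult_le_mono2)
  moreover have "size out \<le> n"
    using adopt size_infrastructure_to_le[OF net Diff_subset] by (simp add: n_def)
  ultimately show ?thesis
    using adopt by simp
next
  case start_round2
  then show ?thesis
    using size_level_broadcast_le[OF net] by (simp add: total_level_def n_def)
qed (simp_all add: total_level_def)

text \<open>The step inequalities telescope, \<open>n ^ 3\<close> being \<open>n\<close> times the
  maximal initial potential. The invariant is carried along because each step inequality assumes
  it.\<close>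

lemma execution_messages:
  assumes net: "sensor_network G s" and "execution G s c m"
  defines "n \<equiv> card (pverts G)"
  shows "levels_supported G s c \<and> m + n * total_level G c \<le> n ^ 3 + phase_budget n (phase c)"
  using assms(2)
proof induction
  case init
  have "n * total_level G (initial_config s) \<le> n * n ^ 2"
    using total_level_le by (simp add: n_def)
  then show ?case
    by (simp add: levels_supported_def initial_config_def power3_eq_cube power2_eq_square)
next
  case (step c m out c')
  then show ?case
    using levels_supported_step[OF net _ step(2)] step_messages[OF net _ step(2)]
    unfolding n_def by force
qed

section \<open>The cubic bound on the worst case\<close>

lemma worst_case_message_complexity_le:
  "worst_case_message_complexity n \<le> enat (n ^ 3 + n ^ 2 + n)"
proof -
  have "enat m \<le> enat (n ^ 3 + n ^ 2 + n)"
    if "sensor_network G s" "card (pverts G) = n" "execution G s c m" for G s c m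
    using execution_messages[OF that(1,3)] phase_budget_le[of n "phase c"] that(2) by force
  then show ?thesis
    unfolding worst_case_message_complexity_def message_complexity_def
    by (auto intro!: SUP_least)
qed

theorem theorem8:
  shows "\<exists>f :: nat \<Rightarrow> nat.
    (\<forall>n. worst_case_message_complexity n = enat (f n)) \<and>
    (\<lambda>n. real (f n)) \<in> O(\<lambda>n. real n ^ 3)"
proof -
  \<comment> \<open>The finite bound excludes the value \<infinity>, so the supremum is given by a
    natural-valued function.\<close>
  have "\<exists>k. worst_case_message_complexity n = enat k" for n
    using enat_ile[OF worst_case_message_complexity_le] by blast
  then obtain f where f: "\<And>n. worst_case_message_complexity n = enat (f n)"
    by metis
  have "real (f n) \<le> 3 * real n ^ 3" for n
  proof -
    have "f n \<le> n ^ 3 + n ^ 2 + n"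
      using worst_case_message_complexity_le[of n] f[of n] by simp
    \<comment> \<open>Each of the three terms is at most \<open>n ^ 3\<close>; monotonicity of
      powers needs \<open>n\<close> at least 1, hence the separate case 0.\<close>
    also have "\<dots> \<le> 3 * n ^ 3"
      by (cases "n = 0") (use power_increasing[of 1 3 n] power_increasing[of 2 3 n] in auto)
    finally show ?thesis
      by (metis of_nat_le_iff of_nat_mult of_nat_numeral of_nat_power)
  qed
  then have "(\<lambda>n. real (f n)) \<in> O(\<lambda>n. real n ^ 3)"
    by (intro bigoI[where c = 3]) simp
  then show ?thesis
    using f by blast
qed

end
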